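(* Let $F$ be an algebraically closed field of characteristic different from $2$, let $G$ be a finite group, $H$ a subgroup of $G$, and $\pi$ an irreducible representation of $G$ over $F$. Suppose that the characteristic of $F$ does not divide $|G|$, or that there exists an anti-involution $\alpha$ of $G$ which preserves $H$ and preserves conjugacy classes. Then $\dim(\pi^{H})=\dim((\pi^{*})^{H})$.
   Context: An anti-involution of $G$ is a map $\alpha:G\to G$ with $\alpha(gh)=\alpha(h)\alpha(g)$ for all $g,h\in G$ and $\alpha\circ\alpha=\mathrm{id}$. It preserves $H$ if $\alpha(H)=H$, and it preserves conjugacy classes if $\alpha(g)$ is conjugate to $g$ in $G$ for every $g\in G$. $\pi^{*}$ is the dual (contragredient) representation of $\pi$, and for a representation $\tau$ of $G$, $\tau^{H}$ is the space of $H$-invariant vectors of $\tau$. Characteristic $0$ is regarded as not dividing $|G|$. *)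

theory Defs
  imports
    "HOL-Algebra.Coset"
    "HOL-Library.Function_Algebras"
    "HOL-Computational_Algebra.Computational_Algebra"
begin

text \<open>
  A representation lives on a linear subspace \<open>V\<close> of an ambient vector space, so that the dual of a
  representation (on a space of functions) is again a representation in the same sense. The values
  of \<open>\<pi> g\<close> outside \<open>V\<close>, and of \<open>\<pi>\<close> outside \<open>carrier G\<close>, are irrelevant.
\<close>

locale group_representation = group G + vs: vector_space scale
  for G :: "('g, 'b) monoid_scheme" (structure)
    and scale :: "'f::field \<Rightarrow> 'v::ab_group_add \<Rightarrow> 'v" (infixr "*s" 75) +
  fixes V :: "'v set" and \<pi> :: "'g \<Rightarrow> 'v \<Rightarrow> 'v"
  assumes subspace_V: "vs.subspace V"
    and rep_closed: "\<lbrakk>g \<in> carrier G; v \<in> V\<rbrakk> \<Longrightarrow> \<pi> g v \<in> V"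
    and rep_add: "\<lbrakk>g \<in> carrier G; v \<in> V; w \<in> V\<rbrakk> \<Longrightarrow> \<pi> g (v + w) = \<pi> g v + \<pi> g w"
    and rep_scale: "\<lbrakk>g \<in> carrier G; v \<in> V\<rbrakk> \<Longrightarrow> \<pi> g (c *s v) = c *s \<pi> g v"
    and rep_one: "v \<in> V \<Longrightarrow> \<pi> \<one> v = v"
    and rep_mult: "\<lbrakk>g \<in> carrier G; h \<in> carrier G; v \<in> V\<rbrakk> \<Longrightarrow> \<pi> (g \<otimes> h) v = \<pi> g (\<pi> h v)"

locale irreducible_representation = group_representation +
  assumes nontrivial: "V \<noteq> {0}"
    and irreducible: "\<lbrakk>vs.subspace W; W \<subseteq> V; \<And>g w. \<lbrakk>g \<in> carrier G; w \<in> W\<rbrakk> \<Longrightarrow> \<pi> g w \<in> W\<rbrakk>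
      \<Longrightarrow> W = {0} \<or> W = V"

definition invariants :: "'v set \<Rightarrow> ('g \<Rightarrow> 'v \<Rightarrow> 'v) \<Rightarrow> 'g set \<Rightarrow> 'v set" where
  "invariants V \<pi> H = {v \<in> V. \<forall>h\<in>H. \<pi> h v = v}"

definition fun_scale :: "'f::field \<Rightarrow> ('v \<Rightarrow> 'f) \<Rightarrow> 'v \<Rightarrow> 'f" where
  "fun_scale c \<phi> = (\<lambda>v. c * \<phi> v)"

text \<open>
  Functionals on \<open>V\<close> are extended by \<open>0\<close> to the ambient space, so that each is represented by
  exactly one function.
\<close>

definition dual_space :: "('f::field \<Rightarrow> 'v::ab_group_add \<Rightarrow> 'v) \<Rightarrow> 'v set \<Rightarrow> ('v \<Rightarrow> 'f) set" where
  "dual_space scale V = {\<phi>. (\<forall>v\<in>V. \<forall>w\<in>V. \<phi> (v + w) = \<phi> v + \<phi> w) \<and>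
     (\<forall>c. \<forall>v\<in>V. \<phi> (scale c v) = c * \<phi> v) \<and> (\<forall>v. v \<notin> V \<longrightarrow> \<phi> v = 0)}"

definition dual_rep :: "('g, 'b) monoid_scheme \<Rightarrow> 'v set \<Rightarrow> ('g \<Rightarrow> 'v \<Rightarrow> 'v) \<Rightarrow>
    'g \<Rightarrow> ('v \<Rightarrow> 'f::field) \<Rightarrow> 'v \<Rightarrow> 'f" where
  "dual_rep G V \<pi> g \<phi> = (\<lambda>v. if v \<in> V then \<phi> (\<pi> (inv\<^bsub>G\<^esub> g) v) else 0)"

definition anti_involution :: "('g, 'b) monoid_scheme \<Rightarrow> ('g \<Rightarrow> 'g) \<Rightarrow> bool" where
  "anti_involution G \<alpha> \<longleftrightarrow> \<alpha> \<in> carrier G \<rightarrow> carrier G \<and>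
     (\<forall>g\<in>carrier G. \<forall>h\<in>carrier G. \<alpha> (g \<otimes>\<^bsub>G\<^esub> h) = \<alpha> h \<otimes>\<^bsub>G\<^esub> \<alpha> g) \<and>
     (\<forall>g\<in>carrier G. \<alpha> (\<alpha> g) = g)"

definition preserves_conjugacy_classes :: "('g, 'b) monoid_scheme \<Rightarrow> ('g \<Rightarrow> 'g) \<Rightarrow> bool" where
  "preserves_conjugacy_classes G \<alpha> \<longleftrightarrow>
     (\<forall>g\<in>carrier G. \<exists>x\<in>carrier G. \<alpha> g = x \<otimes>\<^bsub>G\<^esub> g \<otimes>\<^bsub>G\<^esub> inv\<^bsub>G\<^esub> x)"

lemma vector_space_fun_scale: "vector_space (fun_scale :: 'f::field \<Rightarrow> ('v \<Rightarrow> 'f) \<Rightarrow> 'v \<Rightarrow> 'f)"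
  by unfold_locales (auto simp: fun_scale_def fun_eq_iff algebra_simps)

context group_representation
begin

lemma dual_representation:
  "group_representation G fun_scale (dual_space scale V) (dual_rep G V \<pi>)"
proof -
  interpret D: vector_space "fun_scale :: 'f \<Rightarrow> ('v \<Rightarrow> 'f) \<Rightarrow> 'v \<Rightarrow> 'f"
    by (rule vector_space_fun_scale)
  have VA: "v + w \<in> V" if "v \<in> V" "w \<in> V" for v w
    using subspace_V that by (simp add: vs.subspace_add)
  have VS: "c *s v \<in> V" if "v \<in> V" for c v
    using subspace_V that by (simp add: vs.subspace_scale)
  show ?thesis
  proof (unfold_locales, goal_cases)
    case 1
    show ?case
      by (rule D.subspaceI) (auto simp: dual_space_def fun_scale_def algebra_simps)
  next
    case (2 g \<phi>)
    then show ?case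
      by (auto simp: dual_space_def dual_rep_def rep_closed rep_add rep_scale VA VS)
  next
    case (6 g h \<phi>)
    then show ?case
      by (auto simp: dual_rep_def fun_eq_iff inv_mult_group rep_closed rep_mult)
  qed (auto simp: dual_space_def dual_rep_def fun_scale_def fun_eq_iff rep_one)
qed

end

text \<open>
  \<open>vector_space.dim\<close> is a natural number, with value \<open>0\<close> on infinite-dimensional spaces; an irreducible
  representation of a finite group is finite-dimensional, so this convention plays no role there.
\<close>

lemma (in irreducible_representation) finite_dimensional:
  assumes "finite (carrier G)"
  shows "\<exists>B. finite B \<and> B \<subseteq> V \<and> vs.span B = V"
proof -
  obtain v where v: "v \<in> V" "v \<noteq> 0"
    using nontrivial subspace_V vs.subspace_0 by blast
  let ?B = "(\<lambda>g. \<pi> g v) ` carrier G"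
  have BV: "?B \<subseteq> V" using v rep_closed by auto
  have sub: "vs.span ?B \<subseteq> V" using BV subspace_V by (rule vs.span_minimal)
  have inv: "\<pi> g w \<in> vs.span ?B" if g: "g \<in> carrier G" and w: "w \<in> vs.span ?B" for g w
  proof -
    have "vs.span ?B \<subseteq> {w \<in> V. \<pi> g w \<in> vs.span ?B}"
    proof (rule vs.span_minimal)
      show "?B \<subseteq> {w \<in> V. \<pi> g w \<in> vs.span ?B}"
        using g v by (auto simp: rep_closed rep_mult[symmetric] intro!: vs.span_base)
      have "\<pi> g 0 = 0"
        using rep_scale[OF g v(1), of 0] by simp
      then show "vs.subspace {w \<in> V. \<pi> g w \<in> vs.span ?B}"
        using g subspace_V
        by (auto intro!: vs.subspaceI vs.span_add vs.span_scale vs.span_zero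
            simp: rep_add rep_scale vs.subspace_0 vs.subspace_add vs.subspace_scale)
    qed
    with w show ?thesis by blast
  qed
  have "\<pi> \<one> v \<in> ?B" by (rule imageI) simp
  then have "v \<in> vs.span ?B" using rep_one[OF v(1)] by (simp add: vs.span_base)
  then have "vs.span ?B \<noteq> {0}" using v(2) by auto
  then have "vs.span ?B = V"
    using irreducible[OF vs.subspace_span sub inv] by blast
  with BV assms show ?thesis by (intro exI[of _ ?B]) simp
qed

end

theory Submission
  imports Defs
begin

text \<open>
  If \<open>card H\<close> is invertible in the field, averaging over \<open>H\<close> is a projection \<open>e\<close> of \<open>V\<close> onto \<open>V\<^sup>H\<close>,
  and the \<open>H\<close>-invariant functionals are those with \<open>\<phi> \<circ> e = \<phi>\<close>, that is, the dual of \<open>V\<^sup>H\<close>.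

  Given an anti-involution \<open>\<alpha>\<close>, extend \<open>\<pi> g \<mapsto> \<pi> (\<alpha> g)\<close> linearly to the span \<open>A\<close> of \<open>\<pi> G\<close>. Since \<open>\<alpha>\<close>
  preserves conjugacy classes, this preserves traces, and \<open>A\<close> has enough rank one operators (Burnside)
  for the trace form on \<open>A\<close> to be nondegenerate; hence \<open>\<theta> (\<pi> g) = \<pi> (\<alpha> g)\<close> is a well-defined
  anti-automorphism \<open>\<theta>\<close> of \<open>A\<close>. With \<open>R\<^sub>x = (u \<mapsto> \<phi> u *s x)\<close> in \<open>A\<close> and a linear form \<open>\<psi>\<close> on \<open>V\<close>,
  \<open>B x v = \<psi> (\<theta> R\<^sub>x v)\<close> satisfies \<open>B (\<pi> g x) v = B x (\<pi> (\<alpha> g) v)\<close>. By irreducibility it is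
  nondegenerate as soon as it is nonzero, and as \<open>\<alpha>\<close> preserves \<open>H\<close>, it identifies \<open>V\<^sup>H\<close> with the
  \<open>H\<close>-invariants of the dual.
\<close>

section \<open>Polynomials in an operator, traces and dual bases\<close>

definition poly_action :: "('f::field \<Rightarrow> 'v::ab_group_add \<Rightarrow> 'v) \<Rightarrow>
    'f poly \<Rightarrow> ('v \<Rightarrow> 'v) \<Rightarrow> 'v \<Rightarrow> 'v" where
  "poly_action scale p f w = (\<Sum>i\<le>degree p. scale (coeff p i) ((f ^^ i) w))"

text \<open>Only the values on \<open>B\<close> enter, so a linear operator on the ambient space
  with range in \<open>span B\<close> gets the trace of its restriction to
  \<open>span B\<close>.\<close>

definition trace_on :: "('f::field \<Rightarrow> 'v::ab_group_add \<Rightarrow> 'v) \<Rightarrow>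
    'v set \<Rightarrow> ('v \<Rightarrow> 'v) \<Rightarrow> 'f" where
  "trace_on scale B f = (\<Sum>b\<in>B. module.representation scale B (f b) b)"

context vector_space
begin

text \<open>Extend \<open>w\<close> to a basis \<open>C\<close> of \<open>W\<close>: since
  \<open>f w = 0\<close>, the image is already spanned by the images of
  \<open>C - {w}\<close>.\<close>

lemma dim_linear_image_less:
  assumes f: "Vector_Spaces.linear scale scale f" and W: "subspace W" "W \<subseteq> span F" "finite F"
    and w: "w \<in> W" "w \<noteq> 0" "f w = 0"
  shows "dim (f ` W) < dim W"
proof -
  interpret f: Vector_Spaces.linear scale scale f by fact
  obtain C where C: "{w} \<subseteq> C" "C \<subseteq> W" "independent C" "W \<subseteq> span C"
    using maximal_independent_subset_extend[of "{w}" W] w by auto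
  have fin: "finite C"
    using independent_span_bound[of F C] C W by auto
  have WC: "W = span C"
    using C span_minimal[OF C(2) W(1)] by auto
  have "f ` W = span (f ` C)"
    by (simp add: WC f.span_image)
  also have "f ` C = insert 0 (f ` (C - {w}))"
    using C(1) w(3) by (auto simp: image_iff)
  finally have "f ` W = span (f ` (C - {w}))" by simp
  then have "dim (f ` W) \<le> card (f ` (C - {w}))"
    using fin by (simp add: dim_le_card')
  also have "\<dots> \<le> card (C - {w})" using fin by (simp add: card_image_le)
  also have "\<dots> < card C" using fin C(1) by (intro card_Diff1_less) auto
  also have "card C = dim W" using C by (simp add: basis_card_eq_dim)
  finally show ?thesis .
qed

text \<open>A vector of \<open>T\<close> outside \<open>S\<close> would extend a basis of
  \<open>S\<close> to an independent set larger than a basis of \<open>T\<close>.\<close>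

lemma subspace_eq_if_dim_ge:
  assumes S: "subspace S" "S \<subseteq> T" and T: "T \<subseteq> span F" "finite F" and le: "dim T \<le> dim S"
  shows "S = T"
proof (rule ccontr)
  assume "S \<noteq> T"
  then obtain x where x: "x \<in> T" "x \<notin> S" using S by auto
  obtain B where B: "B \<subseteq> S" "independent B" "S \<subseteq> span B" "card B = dim S"
    by (rule basis_exists)
  obtain C where C: "C \<subseteq> T" "independent C" "T \<subseteq> span C" "card C = dim T"
    by (rule basis_exists)
  have "finite C" using independent_span_bound[OF T(2) C(2)] C(1) T(1) by auto
  have xB: "x \<notin> span B" using x(2) B(1) S(1) span_minimal by blast
  then have "independent (insert x B)" using B(2) by (rule independent_insertI)
  moreover have "insert x B \<subseteq> span C" using x(1) B(1) S(2) C(3) by blast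
  ultimately have *: "finite (insert x B) \<and> card (insert x B) \<le> card C"
    by (rule independent_span_bound[OF \<open>finite C\<close>])
  moreover have "x \<notin> B" using xB span_base by blast
  moreover have "finite B" using * by simp
  ultimately show False using le B(4) C(4) by simp
qed

lemma poly_action_eq_sum:
  fixes p :: "'a poly"
  assumes "\<And>i. i \<ge> n \<Longrightarrow> coeff p i = 0"
  shows "poly_action scale p f w = (\<Sum>i<n. scale (coeff p i) ((f ^^ i) w))"
proof -
  have "(\<Sum>i\<in>{..degree p}. scale (coeff p i) ((f ^^ i) w)) =
        (\<Sum>i\<in>{..degree p} \<union> {..<n}. scale (coeff p i) ((f ^^ i) w))"
    by (rule sum.mono_neutral_left) (auto simp: coeff_eq_0)
  also have "\<dots> = (\<Sum>i<n. scale (coeff p i) ((f ^^ i) w))"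
    by (rule sum.mono_neutral_right) (use assms in \<open>auto simp: not_less\<close>)
  finally show ?thesis by (simp add: poly_action_def)
qed

text \<open>The coefficient of the product at \<open>i\<close> is that of \<open>q\<close> at
  \<open>i - 1\<close> minus \<open>c\<close> times that of \<open>q\<close> at \<open>i\<close>.
  This lets an induction on the degree move a linear factor from the polynomial to the
  vector.\<close>

lemma poly_action_linear_factor:
  assumes "Vector_Spaces.linear scale scale f"
  shows "poly_action scale ([:- c, 1:] * q) f w = poly_action scale q f (f w - scale c w)"
proof -
  interpret f: Vector_Spaces.linear scale scale f by fact
  have pow: "(f ^^ i) (x - scale c y) = (f ^^ i) x - scale c ((f ^^ i) y)" for i x y
    by (induction i) (simp_all add: f.diff f.scale)
  define n where "n = Suc (degree q)"
  have q0: "coeff q i = 0" if "i \<ge> n" for i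
    using that by (simp add: n_def coeff_eq_0)
  have co: "coeff ([:- c, 1:] * q) i = (case i of 0 \<Rightarrow> 0 | Suc j \<Rightarrow> coeff q j) - c * coeff q i" for i
    by (cases i) simp_all
  have 1: "(\<Sum>i<Suc n. scale (c * coeff q i) ((f ^^ i) w)) = (\<Sum>i<n. scale (c * coeff q i) ((f ^^ i) w))"
    by (simp add: q0)
  have 2: "(\<Sum>i<Suc n. scale (case i of 0 \<Rightarrow> 0 | Suc j \<Rightarrow> coeff q j) ((f ^^ i) w)) =
      (\<Sum>i<n. scale (coeff q i) ((f ^^ i) (f w)))"
    by (subst sum.lessThan_Suc_shift) (simp add: funpow_swap1)
  have "poly_action scale ([:- c, 1:] * q) f w = (\<Sum>i<Suc n. scale (coeff ([:- c, 1:] * q) i) ((f ^^ i) w))"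
    by (rule poly_action_eq_sum) (auto simp only: co q0 split: nat.split; simp add: q0)
  also have "\<dots> = (\<Sum>i<Suc n. scale (case i of 0 \<Rightarrow> 0 | Suc j \<Rightarrow> coeff q j) ((f ^^ i) w))
        - (\<Sum>i<Suc n. scale (c * coeff q i) ((f ^^ i) w))"
    unfolding co by (simp only: scale_left_diff_distrib sum_subtractf)
  also have "\<dots> = (\<Sum>i<n. scale (coeff q i) ((f ^^ i) (f w - scale c w)))"
    unfolding 1 2 by (simp add: sum_subtractf pow scale_right_diff_distrib mult.commute)
  also have "\<dots> = poly_action scale q f (f w - scale c w)"
    by (rule poly_action_eq_sum[symmetric]) (rule q0)
  finally show ?thesis .
qed

lemma annihilating_poly_exists:
  assumes "finite F" and orb: "\<And>i. (f ^^ i) w \<in> span F"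
  shows "\<exists>p. p \<noteq> 0 \<and> poly_action scale p f w = 0"
proof -
  \<comment> \<open>\<open>dependent\<close> speaks of sets, so a repetition among the iterates of
    \<open>w\<close> is treated apart: it is itself a linear relation.\<close>
  obtain I c and i :: nat where I: "finite I" "i \<in> I" "c i \<noteq> 0" "(\<Sum>i\<in>I. scale (c i) ((f ^^ i) w)) = 0"
  proof (cases "inj (\<lambda>i. (f ^^ i) w)")
    case True
    have "\<not> finite (range (\<lambda>i. (f ^^ i) w))"
      using True finite_imageD by blast
    then have "dependent (range (\<lambda>i. (f ^^ i) w))"
      using independent_span_bound[OF assms(1)] orb by blast
    then obtain T u v where T: "finite T" "T \<subseteq> range (\<lambda>i. (f ^^ i) w)"
      "(\<Sum>v\<in>T. scale (u v) v) = 0" "v \<in> T" "u v \<noteq> 0"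
      unfolding dependent_explicit by blast
    obtain I where I: "T = (\<lambda>i. (f ^^ i) w) ` I"
      using T(2) by (auto simp: subset_image_iff)
    have inj: "inj_on (\<lambda>i. (f ^^ i) w) I" using True by (rule inj_on_subset) simp
    obtain i where "i \<in> I" "v = (f ^^ i) w" using T(4) I by auto
    with T I inj that[of I i "\<lambda>i. u ((f ^^ i) w)"] show ?thesis
      by (auto simp: sum.reindex finite_image_iff)
  next
    case False
    then obtain i j where "i \<noteq> j" "(f ^^ i) w = (f ^^ j) w" by (auto simp: inj_def)
    then show ?thesis
      by (intro that[of "{i, j}" i "\<lambda>k. if k = i then 1 else -1"]) auto
  qed
  define n where "n = Suc (Max I)"
  have n: "I \<subseteq> {..<n}" using I(1) by (auto simp: n_def less_Suc_eq_le)
  define p where "p = Poly (map (\<lambda>i. if i \<in> I then c i else 0) [0..<n])"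
  have p: "coeff p k = (if k \<in> I then c k else 0)" for k
    using n by (auto simp: p_def coeff_Poly_eq nth_default_def)
  have "poly_action scale p f w = (\<Sum>i<n. scale (coeff p i) ((f ^^ i) w))"
    using n by (intro poly_action_eq_sum) (auto simp: p)
  also have "\<dots> = (\<Sum>i\<in>I. scale (c i) ((f ^^ i) w))"
    using n by (intro sum.mono_neutral_cong_right) (auto simp: p)
  finally have "poly_action scale p f w = 0" using I(4) by simp
  moreover have "p \<noteq> 0" using I(2,3) p[of i] by auto
  ultimately show ?thesis by blast
qed

context
  fixes B assumes B: "independent B" "finite B"
begin

lemma trace_on_add:
  assumes "\<And>v. f v \<in> span B" "\<And>v. g v \<in> span B"
  shows "trace_on scale B (\<lambda>v. f v + g v) = trace_on scale B f + trace_on scale B g"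
  by (simp add: trace_on_def representation_add B assms sum.distrib)

lemma trace_on_scale:
  assumes "\<And>v. f v \<in> span B"
  shows "trace_on scale B (\<lambda>v. scale c (f v)) = c * trace_on scale B f"
  by (simp add: trace_on_def representation_scale B assms sum_distrib_left)

lemma trace_on_zero: "trace_on scale B (\<lambda>v. 0) = 0"
  by (simp add: trace_on_def representation_zero)

text \<open>These are the diagonal entries of a matrix product; exchanging the two sums then gives
  \<open>trace_on_commute\<close>.\<close>

lemma trace_on_compose:
  assumes f: "Vector_Spaces.linear scale scale f" "\<And>v. f v \<in> span B"
    and g: "\<And>v. g v \<in> span B"
  shows "trace_on scale B (\<lambda>v. f (g v)) = (\<Sum>b\<in>B. \<Sum>c\<in>B. representation B (g b) c * representation B (f c) b)"
proof -
  interpret f: Vector_Spaces.linear scale scale f by fact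
  have "representation B (f (g b)) b = (\<Sum>c\<in>B. representation B (g b) c * representation B (f c) b)" for b
  proof -
    have "f (g b) = f (\<Sum>c\<in>B. scale (representation B (g b) c) c)"
      by (subst sum_representation_eq) (auto simp: B g)
    also have "\<dots> = (\<Sum>c\<in>B. scale (representation B (g b) c) (f c))"
      by (simp add: f.sum f.scale)
    also have "representation B \<dots> b = (\<Sum>c\<in>B. representation B (g b) c * representation B (f c) b)"
      by (simp add: representation_sum representation_scale B f span_scale)
    finally show ?thesis .
  qed
  then show ?thesis by (simp add: trace_on_def)
qed

lemma trace_on_commute:
  assumes "Vector_Spaces.linear scale scale f" "\<And>v. f v \<in> span B"
    and "Vector_Spaces.linear scale scale g" "\<And>v. g v \<in> span B"
  shows "trace_on scale B (\<lambda>v. f (g v)) = trace_on scale B (\<lambda>v. g (f v))"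
  using trace_on_compose[OF assms(1,2,4)] trace_on_compose[OF assms(3,4,2)]
  by (subst (asm) sum.swap) (simp add: mult.commute)

text \<open>Expand \<open>z\<close> in the basis: the diagonal entries are the terms of
  \<open>\<phi> z\<close>.\<close>

lemma trace_on_rank_one:
  assumes \<phi>: "Vector_Spaces.linear scale (*) \<phi>" and z: "z \<in> span B"
  shows "trace_on scale B (\<lambda>u. scale (\<phi> u) z) = \<phi> z"
proof -
  interpret \<phi>: Vector_Spaces.linear scale "(*)" \<phi> by fact
  have "\<phi> z = \<phi> (\<Sum>b\<in>B. scale (representation B z b) b)"
    by (subst sum_representation_eq) (auto simp: B z)
  also have "\<dots> = (\<Sum>b\<in>B. representation B z b * \<phi> b)"
    by (simp add: \<phi>.sum \<phi>.scale)
  finally show ?thesis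
    by (simp add: trace_on_def representation_scale B z mult.commute)
qed

end

lemma dual_space_zero:
  assumes "subspace V" "\<phi> \<in> dual_space scale V"
  shows "\<phi> 0 = 0"
proof -
  have "\<phi> (scale 0 0) = 0 * \<phi> 0"
    using assms subspace_0 unfolding dual_space_def by blast
  then show ?thesis by simp
qed

lemma dual_space_sum:
  assumes "subspace V" "\<phi> \<in> dual_space scale V" "\<And>i. i \<in> I \<Longrightarrow> f i \<in> V"
  shows "\<phi> (sum f I) = (\<Sum>i\<in>I. \<phi> (f i))"
  using assms(3)
proof (induction I rule: infinite_finite_induct)
  case (insert i I)
  then have "f i \<in> V" "sum f I \<in> V" using assms(1) by (auto intro: subspace_sum)
  then have "\<phi> (f i + sum f I) = \<phi> (f i) + \<phi> (sum f I)"
    using assms(2) unfolding dual_space_def by blast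
  then show ?case using insert by simp
qed (auto simp: dual_space_zero[OF assms(1,2)])

lemma dual_space_scale:
  "\<phi> \<in> dual_space scale V \<Longrightarrow> v \<in> V \<Longrightarrow> \<phi> (scale c v) = c * \<phi> v"
  by (simp add: dual_space_def)

text \<open>A functional fixed by precomposition with the projection \<open>e\<close> is determined
  by its values on \<open>W\<close>, so these functionals form the dual of \<open>W\<close>. With
  \<open>e\<close> an average this counts invariant functionals; with \<open>e\<close> the identity
  it gives the dimension of the full dual.\<close>

lemma projection_invariant_functionals:
  assumes V: "subspace V" and W: "subspace W" "W \<subseteq> V" "W \<subseteq> span F" "finite F"
    and e_add: "\<And>v w. v \<in> V \<Longrightarrow> w \<in> V \<Longrightarrow> e (v + w) = e v + e w"
    and e_scale: "\<And>c v. v \<in> V \<Longrightarrow> e (scale c v) = scale c (e v)"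
    and e_range: "\<And>v. v \<in> V \<Longrightarrow> e v \<in> W" and e_id: "\<And>v. v \<in> W \<Longrightarrow> e v = v"
  shows "\<exists>D. finite D \<and> module.span fun_scale D = {\<phi> \<in> dual_space scale V. \<forall>v\<in>V. \<phi> (e v) = \<phi> v} \<and>
    vector_space.dim fun_scale {\<phi> \<in> dual_space scale V. \<forall>v\<in>V. \<phi> (e v) = \<phi> v} = dim W"
proof -
  interpret D: vector_space "fun_scale :: 'a \<Rightarrow> ('b \<Rightarrow> 'a) \<Rightarrow> 'b \<Rightarrow> 'a"
    by (rule vector_space_fun_scale)
  let ?S = "{\<phi> \<in> dual_space scale V. \<forall>v\<in>V. \<phi> (e v) = \<phi> v}"
  obtain C where C: "C \<subseteq> W" "independent C" "W \<subseteq> span C" "card C = dim W"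
    by (rule basis_exists)
  have fin: "finite C" using independent_span_bound[OF W(4) C(2)] C(1) W(3) by auto
  have eC: "e v \<in> span C" if "v \<in> V" for v using e_range[OF that] C(3) by auto
  have eV: "e v \<in> V" if "v \<in> V" for v using e_range[OF that] W(2) by auto
  \<comment> \<open>The dual basis of \<open>C\<close>, pulled back along \<open>e\<close> and cut
    off outside \<open>V\<close> to match \<open>dual_space\<close>.\<close>
  define \<delta> where "\<delta> c = (\<lambda>v. if v \<in> V then representation C (e v) c else 0)" for c
  have sum_app: "(\<Sum>c\<in>C. fun_scale (a c) (\<delta> c)) v = (\<Sum>c\<in>C. a c * \<delta> c v)" for a v
    using fin by (induction C rule: finite_induct) (auto simp: fun_scale_def)
  have \<delta>C: "\<delta> c d = (if d = c then 1 else 0)" if "d \<in> C" "c \<in> C" for c d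
    using that C(1) W(2) by (auto simp: \<delta>_def e_id subset_iff representation_basis C(2))
  have inj: "inj_on \<delta> C"
    by (rule inj_onI) (metis \<delta>C zero_neq_one)
  have D: "D.span (\<delta> ` C) = ?S"
  proof (intro subset_antisym D.span_minimal)
    show "\<delta> ` C \<subseteq> ?S"
      using V by (auto simp: dual_space_def \<delta>_def e_add e_scale representation_add representation_scale
          C(2) eC eV e_id e_range subspace_add subspace_scale)
    show "D.subspace ?S"
      by (rule D.subspaceI) (auto simp: dual_space_def fun_scale_def algebra_simps)
  next
    show "?S \<subseteq> D.span (\<delta> ` C)"
    proof
      fix \<phi> assume \<phi>: "\<phi> \<in> ?S"
      have \<phi>_sum: "\<phi> (\<Sum>c\<in>C. scale (a c) c) = (\<Sum>c\<in>C. a c * \<phi> c)" for a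
      proof -
        have "c \<in> V" if "c \<in> C" for c using that C(1) W(2) by auto
        then show ?thesis
          using \<phi> by (simp add: dual_space_sum[OF V] dual_space_scale[where V=V] subspace_scale[OF V])
      qed
      have "\<phi> = (\<Sum>c\<in>C. fun_scale (\<phi> c) (\<delta> c))"
      proof
        fix v
        show "\<phi> v = (\<Sum>c\<in>C. fun_scale (\<phi> c) (\<delta> c)) v"
        proof (cases "v \<in> V")
          case True
          have "\<phi> v = \<phi> (e v)" using \<phi> True by simp
          also have "e v = (\<Sum>c\<in>C. scale (representation C (e v) c) c)"
            by (subst sum_representation_eq) (auto simp: C(2) eC True fin)
          also have "\<phi> \<dots> = (\<Sum>c\<in>C. representation C (e v) c * \<phi> c)" using \<phi>_sum by simp
          finally show ?thesis unfolding sum_app using True by (simp add: \<delta>_def mult.commute)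
        next
          case False
          then show ?thesis unfolding sum_app using \<phi> by (simp add: \<delta>_def dual_space_def)
        qed
      qed
      then show "\<phi> \<in> D.span (\<delta> ` C)"
        by (metis (no_types, lifting) D.span_base D.span_scale D.span_sum imageI)
    qed
  qed
  have "D.independent (\<delta> ` C)"
  proof (rule D.independent_if_scalars_zero)
    show "finite (\<delta> ` C)" using fin by simp
    fix f x assume 0: "(\<Sum>x\<in>\<delta> ` C. fun_scale (f x) x) = 0" and "x \<in> \<delta> ` C"
    then obtain c where c: "c \<in> C" "x = \<delta> c" by auto
    have "0 = (\<Sum>d\<in>C. f (\<delta> d) * \<delta> d c)"
      using fun_cong[OF 0, of c] by (simp add: sum.reindex inj sum_app)
    also have "\<dots> = (\<Sum>d\<in>C. if d = c then f (\<delta> d) else 0)"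
      using c by (intro sum.cong) (auto simp: \<delta>C)
    finally show "f x = 0" using c fin by simp
  qed
  then have "D.dim ?S = card (\<delta> ` C)"
    unfolding D[symmetric] by (rule D.dim_span_eq_card_independent)
  then show ?thesis using D fin C(4) inj
    by (intro exI[of _ "\<delta> ` C"]) (simp add: card_image)
qed

end

lemma (in vector_space_pair) dim_inj_linear_image:
  assumes "Vector_Spaces.linear s1 s2 f" "vs1.subspace W" "inj_on f W"
  shows "vs2.dim (f ` W) = vs1.dim W"
proof -
  obtain B where B: "B \<subseteq> W" "vs1.independent B" "W \<subseteq> vs1.span B" "card B = vs1.dim W"
    by (rule vs1.basis_exists)
  have W: "vs1.span B = W" using B vs1.span_minimal[OF B(1) assms(2)] by auto
  have "vs2.independent (f ` B)"
    using linear_independent_injective_image[OF assms(1) B(2)] assms(3) W by simp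
  moreover have "vs2.span (f ` B) = f ` W" using linear_span_image[OF assms(1)] W by simp
  ultimately have "vs2.dim (f ` W) = card (f ` B)" by (metis vs2.dim_span_eq_card_independent)
  then show ?thesis using B(1,4) assms(3) by (simp add: card_image inj_on_subset)
qed

section \<open>Eigenvectors and operators of rank one\<close>

lemma eigenvector_exists:
  fixes scale :: "'f::alg_closed_field \<Rightarrow> 'v::ab_group_add \<Rightarrow> 'v"
  assumes "vector_space scale" and f: "Vector_Spaces.linear scale scale f"
    and W: "module.subspace scale W" "W \<subseteq> module.span scale F" "finite F"
    and fW: "\<And>w. w \<in> W \<Longrightarrow> f w \<in> W" and w: "w \<in> W" "w \<noteq> 0"
  shows "\<exists>x\<in>W. \<exists>c. x \<noteq> 0 \<and> f x = scale c x"
proof -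
  interpret vector_space scale by fact
  \<comment> \<open>Induction on the degree of a polynomial killing \<open>w\<close>: for a root
    \<open>c\<close>, either \<open>w\<close> is an eigenvector, or \<open>f w - scale c w\<close>
    is nonzero and killed by the cofactor \<open>q\<close>. A nonzero constant cannot kill
    \<open>w\<close>.\<close>
  have main: "\<exists>x\<in>W. \<exists>c. x \<noteq> 0 \<and> f x = scale c x"
    if "p \<noteq> 0" "poly_action scale p f w = 0" "w \<in> W" "w \<noteq> 0" for p w
    using that
  proof (induction "degree p" arbitrary: p w)
    case 0
    then show ?case using leading_coeff_0_iff[of p] by (simp add: poly_action_def)
  next
    case (Suc n)
    obtain c where "poly p c = 0"
      using alg_closed_imp_poly_has_root[of p] Suc(2) by auto
    then obtain q where q: "p = [:- c, 1:] * q" by (auto simp: poly_eq_0_iff_dvd dvd_def)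
    with Suc have "q \<noteq> 0" by auto
    have deg: "n = degree q" using Suc(2) \<open>q \<noteq> 0\<close> unfolding q by (subst (asm) degree_mult_eq) auto
    show ?case
    proof (cases "f w = scale c w")
      case True
      then show ?thesis using Suc by blast
    next
      case False
      have "f w - scale c w \<in> W"
        using Suc.prems(3) by (simp add: fW W(1) subspace_diff subspace_scale)
      then show ?thesis
        using Suc(1)[OF deg \<open>q \<noteq> 0\<close>, of "f w - scale c w"] Suc.prems(2) False
        unfolding q poly_action_linear_factor[OF f] by simp
    qed
  qed
  have "(f ^^ i) w \<in> W" for i by (induction i) (auto simp: w fW)
  then have "(f ^^ i) w \<in> span F" for i using W(2) by blast
  from annihilating_poly_exists[OF W(3) this] main w show ?thesis by blast
qed

lemma vector_space_mult: "vector_space ((*) :: 'f::field \<Rightarrow> 'f \<Rightarrow> 'f)"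
  by unfold_locales (auto simp: algebra_simps)

text \<open>
  The core of Burnside's theorem, following Lomonosov and Rosenthal: an operator \<open>T\<close> of minimal rank
  has rank one, as otherwise \<open>TST - cT\<close>, with \<open>c\<close> an eigenvalue of \<open>TS\<close> on the range of \<open>T\<close>, has
  smaller nonzero rank.
\<close>

lemma rank_one_operator_exists:
  fixes scale :: "'f::alg_closed_field \<Rightarrow> 'v::ab_group_add \<Rightarrow> 'v"
  assumes vs: "vector_space scale"
    and V: "module.subspace scale V" "V \<subseteq> module.span scale F" "finite F"
    and lin: "\<And>X. X \<in> A \<Longrightarrow> Vector_Spaces.linear scale scale X"
    and range_A: "\<And>X. X \<in> A \<Longrightarrow> range X \<subseteq> X ` V" "\<And>X v. X \<in> A \<Longrightarrow> X v \<in> V"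
    and comp: "\<And>X Y. X \<in> A \<Longrightarrow> Y \<in> A \<Longrightarrow> (\<lambda>v. X (Y v)) \<in> A"
    and diff: "\<And>X Y c. X \<in> A \<Longrightarrow> Y \<in> A \<Longrightarrow> (\<lambda>v. X v - scale c (Y v)) \<in> A"
    and transitive: "\<And>v w. v \<in> V \<Longrightarrow> v \<noteq> 0 \<Longrightarrow> w \<in> V \<Longrightarrow> \<exists>X\<in>A. X v = w"
    and nonzero: "\<exists>X\<in>A. \<exists>v. X v \<noteq> 0"
  shows "\<exists>\<phi>. \<exists>y\<in>V. Vector_Spaces.linear scale (*) \<phi> \<and> (\<lambda>v. scale (\<phi> v) y) \<in> A \<and> y \<noteq> 0 \<and> (\<exists>v. \<phi> v \<noteq> 0)"
proof -
  interpret vector_space scale by fact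
  define nz where "nz X \<longleftrightarrow> X \<in> A \<and> (\<exists>v. X v \<noteq> 0)" for X
  obtain X0 where "nz X0" using nonzero by (auto simp: nz_def)
  from ex_has_least_nat[of nz X0 "\<lambda>X. dim (X ` V)", OF this]
  obtain T where T: "nz T" and least: "\<And>X. nz X \<Longrightarrow> dim (T ` V) \<le> dim (X ` V)"
    by auto
  then obtain u where TA: "T \<in> A" and u: "T u \<noteq> 0" by (auto simp: nz_def)
  interpret T: Vector_Spaces.linear scale scale T by (rule lin[OF TA])
  define y where "y = T u"
  have y: "y \<in> V" "y \<noteq> 0" using range_A(2)[OF TA] u by (auto simp: y_def)
  have T1: "T x \<in> span {y}" for x
  proof (rule ccontr)
    assume x: "T x \<notin> span {y}"
    \<comment> \<open>Transitivity only reaches targets in \<open>V\<close>, so \<open>x\<close> is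
      replaced by a vector of \<open>V\<close> with the same image under \<open>T\<close>.\<close>
    obtain x' where x': "x' \<in> V" "T x = T x'"
      using range_A(1)[OF TA] by blast
    obtain S where S: "S \<in> A" "S y = x'" using transitive[OF y x'(1)] by blast
    interpret S: Vector_Spaces.linear scale scale S by (rule lin[OF S(1)])
    let ?W = "T ` V"
    have W: "subspace ?W" using V(1) by (rule T.subspace_image)
    have WV: "?W \<subseteq> V" using range_A(2)[OF TA] by auto
    have TS: "Vector_Spaces.linear scale scale (\<lambda>v. T (S v))"
      by (rule lin[OF comp[OF TA S(1)]])
    obtain w c where w: "w \<in> ?W" "w \<noteq> 0" "T (S w) = scale c w"
    proof -
      have "y \<in> ?W" using range_A(1)[OF TA] by (auto simp: y_def)
      moreover have "T (S w) \<in> ?W" for w using range_A(2)[OF S(1)] by blast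
      moreover have "?W \<subseteq> span F" using WV V(2) by simp
      ultimately have "\<exists>x\<in>?W. \<exists>c. x \<noteq> 0 \<and> T (S x) = scale c x"
        using y(2) by (intro eigenvector_exists[OF vs TS W _ V(3)])
      then show ?thesis using that by metis
    qed
    let ?N = "\<lambda>v. T (S v) - scale c v"
    let ?X = "\<lambda>v. T (S (T v)) - scale c (T v)"
    have N: "Vector_Spaces.linear scale scale ?N"
      by (simp add: Vector_Spaces.linear_iff vs T.add T.scale S.add S.scale algebra_simps mult.commute)
    \<comment> \<open>Here \<open>S (T u) = x'\<close>, so \<open>?X u = T x - scale c y\<close>,
      and \<open>T x\<close> is not a multiple of \<open>y\<close>.\<close>
    have "?X u \<noteq> 0"
    proof
      assume "?X u = 0"
      then have "T x = scale c y" using S(2) x'(2) by (simp add: y_def)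
      then show False using x by (simp add: span_base span_scale)
    qed
    moreover have "?X \<in> A" using diff[OF comp[OF TA comp[OF S(1) TA]] TA] .
    ultimately have "nz ?X" by (auto simp: nz_def)
    then have "dim ?W \<le> dim (?X ` V)" by (rule least)
    \<comment> \<open>\<open>?X\<close> is \<open>?N\<close> after \<open>T\<close>, and
      \<open>?N\<close> kills the eigenvector \<open>w\<close> in \<open>?W\<close>, so the rank
      drops.\<close>
    also have "?X ` V = ?N ` ?W" by auto
    also have "dim \<dots> < dim ?W"
      using dim_linear_image_less[OF N W _ V(3) w(1,2)] w(3) WV V(2) by auto
    finally show False by simp
  qed
  define \<phi> where "\<phi> v = representation {y} (T v) y" for v
  have ind: "independent {y}" using y(2) by simp
  have T_eq: "T v = scale (\<phi> v) y" for v
    using sum_representation_eq[OF ind T1[of v], of "{y}"] by (simp add: \<phi>_def)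
  have "Vector_Spaces.linear scale (*) \<phi>"
    by (simp add: Vector_Spaces.linear_iff vs vector_space_mult \<phi>_def T.add T.scale representation_add[OF ind T1 T1] representation_scale[OF ind T1])
  moreover have "\<phi> u \<noteq> 0" using T_eq[of u] u by auto
  moreover have "(\<lambda>v. scale (\<phi> v) y) \<in> A" using TA by (simp flip: T_eq)
  ultimately show ?thesis using y by blast
qed

section \<open>Invariant functionals and the averaging operator\<close>

context group_representation
begin

lemma rep_zero: "g \<in> carrier G \<Longrightarrow> \<pi> g 0 = 0"
  using rep_scale[of g 0 0] subspace_V vs.subspace_0 by auto

lemma rep_sum:
  assumes "g \<in> carrier G" "\<And>i. i \<in> I \<Longrightarrow> f i \<in> V"
  shows "\<pi> g (sum f I) = (\<Sum>i\<in>I. \<pi> g (f i))"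
  using assms(2)
  by (induction I rule: infinite_finite_induct)
    (auto simp: rep_zero assms(1) rep_add vs.subspace_sum[OF subspace_V])

lemma subspace_invariants: "H \<subseteq> carrier G \<Longrightarrow> vs.subspace (invariants V \<pi> H)"
  by (rule vs.subspaceI)
    (use subspace_V in \<open>auto simp: invariants_def vs.subspace_0 vs.subspace_add vs.subspace_scale
      rep_zero rep_add rep_scale subset_iff\<close>)

text \<open>Passing from \<open>h\<close> to its inverse inside \<open>H\<close> removes the inverse
  built into \<open>dual_rep\<close>; off \<open>V\<close> both functions vanish.\<close>

lemma dual_invariants_eq:
  assumes "subgroup H G"
  shows "invariants (dual_space scale V) (dual_rep G V \<pi>) H =
    {\<phi> \<in> dual_space scale V. \<forall>h\<in>H. \<forall>v\<in>V. \<phi> (\<pi> h v) = \<phi> v}"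
proof -
  have "(\<forall>h\<in>H. dual_rep G V \<pi> h \<phi> = \<phi>) \<longleftrightarrow> (\<forall>h\<in>H. \<forall>v\<in>V. \<phi> (\<pi> h v) = \<phi> v)"
    if "\<phi> \<in> dual_space scale V" for \<phi>
  proof -
    have "(\<forall>h\<in>H. dual_rep G V \<pi> h \<phi> = \<phi>) \<longleftrightarrow> (\<forall>h\<in>H. \<forall>v\<in>V. \<phi> (\<pi> (inv h) v) = \<phi> v)"
      using that by (auto simp: dual_rep_def dual_space_def fun_eq_iff)
    also have "\<dots> \<longleftrightarrow> (\<forall>h\<in>H. \<forall>v\<in>V. \<phi> (\<pi> h v) = \<phi> v)"
      using assms subgroup.m_inv_closed[OF assms] subgroup.mem_carrier[OF assms]
      by (metis inv_inv)
    finally show ?thesis .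
  qed
  then show ?thesis by (auto simp: invariants_def)
qed

definition average :: "'g set \<Rightarrow> 'v \<Rightarrow> 'v" where
  "average H v = scale (inverse (of_nat (card H))) (\<Sum>h\<in>H. \<pi> h v)"

lemma dim_dual_invariants_nonmodular:
  assumes H: "subgroup H G" "finite H" "of_nat (card H) \<noteq> (0::'f)" and V: "finite F" "V \<subseteq> vs.span F"
  shows "vector_space.dim fun_scale (invariants (dual_space scale V) (dual_rep G V \<pi>) H) =
    vs.dim (invariants V \<pi> H)"
proof -
  let ?W = "invariants V \<pi> H"
  have HG: "H \<subseteq> carrier G" and HG': "\<And>h. h \<in> H \<Longrightarrow> h \<in> carrier G"
    using H(1) subgroup.subset by auto
  have closed: "average H v \<in> V" if "v \<in> V" for v
    using that subspace_V
    by (auto simp: average_def HG' rep_closed intro!: vs.subspace_scale vs.subspace_sum)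
  have sum_V: "(\<Sum>h\<in>H. \<pi> h v) \<in> V" if "v \<in> V" for v
    using that subspace_V by (auto simp: HG' rep_closed intro!: vs.subspace_sum)
  \<comment> \<open>Left translation by \<open>k\<close> permutes \<open>H\<close>, so averages are
    \<open>H\<close>-invariant.\<close>
  have avg_fixed: "\<pi> k (average H v) = average H v" if "k \<in> H" "v \<in> V" for k v
  proof -
    have "\<pi> k (average H v) = scale (inverse (of_nat (card H))) (\<Sum>h\<in>H. \<pi> (k \<otimes> h) v)"
      using that by (simp add: average_def rep_scale rep_sum rep_closed rep_mult HG' sum_V)
    also have "(\<Sum>h\<in>H. \<pi> (k \<otimes> h) v) = (\<Sum>h\<in>(\<lambda>h. k \<otimes> h) ` H. \<pi> h v)"
      using that by (subst sum.reindex) (auto simp: inj_on_def HG')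
    also have "(\<lambda>h. k \<otimes> h) ` H = H"
    proof (rule endo_inj_surj[OF H(2)])
      show "(\<lambda>h. k \<otimes> h) ` H \<subseteq> H" using that H(1) by (auto intro: subgroup.m_closed)
      show "inj_on (\<lambda>h. k \<otimes> h) H" using that by (auto simp: inj_on_def HG')
    qed
    finally show ?thesis by (simp add: average_def)
  qed
  have W: "average H v = v" if "v \<in> ?W" for v
  proof -
    have "(\<Sum>h\<in>H. \<pi> h v) = (\<Sum>h\<in>H. v)" using that by (simp add: invariants_def)
    then show ?thesis using H(3) by (simp add: average_def vs.sum_constant_scale)
  qed
  \<comment> \<open>Forwards, the sum over \<open>H\<close> has \<open>card H\<close> equal terms;
    backwards, right translation by \<open>k\<close> permutes \<open>H\<close>, so
    \<open>average H\<close> does not see \<open>\<pi> k\<close>.\<close>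
  have \<phi>: "(\<forall>h\<in>H. \<forall>v\<in>V. \<phi> (\<pi> h v) = \<phi> v) \<longleftrightarrow> (\<forall>v\<in>V. \<phi> (average H v) = \<phi> v)"
    if "\<phi> \<in> dual_space scale V" for \<phi>
  proof
    assume *: "\<forall>h\<in>H. \<forall>v\<in>V. \<phi> (\<pi> h v) = \<phi> v"
    show "\<forall>v\<in>V. \<phi> (average H v) = \<phi> v"
    proof
      fix v assume v: "v \<in> V"
      have "\<phi> (\<Sum>h\<in>H. \<pi> h v) = of_nat (card H) * \<phi> v"
        using * v by (simp add: vs.dual_space_sum[OF subspace_V that] HG' rep_closed)
      then show "\<phi> (average H v) = \<phi> v"
        using H(3) by (simp add: average_def vs.dual_space_scale[OF that] sum_V v)
    qed
  next
    assume *: "\<forall>v\<in>V. \<phi> (average H v) = \<phi> v"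
    have "average H (\<pi> k v) = average H v" if "k \<in> H" "v \<in> V" for k v
    proof -
      have "(\<Sum>h\<in>H. \<pi> h (\<pi> k v)) = (\<Sum>h\<in>H. \<pi> (h \<otimes> k) v)"
        using that by (simp add: rep_mult HG')
      also have "\<dots> = (\<Sum>h\<in>(\<lambda>h. h \<otimes> k) ` H. \<pi> h v)"
        using that by (subst sum.reindex) (auto simp: inj_on_def HG')
      also have "(\<lambda>h. h \<otimes> k) ` H = H"
      proof (rule endo_inj_surj[OF H(2)])
        show "(\<lambda>h. h \<otimes> k) ` H \<subseteq> H" using that H(1) by (auto intro: subgroup.m_closed)
        show "inj_on (\<lambda>h. h \<otimes> k) H" using that by (auto simp: inj_on_def HG')
      qed
      finally show ?thesis by (simp add: average_def)
    qed
    with * show "\<forall>h\<in>H. \<forall>v\<in>V. \<phi> (\<pi> h v) = \<phi> v"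
      by (metis HG' rep_closed)
  qed
  have "vector_space.dim fun_scale {\<phi> \<in> dual_space scale V. \<forall>v\<in>V. \<phi> (average H v) = \<phi> v} = vs.dim ?W"
  proof (rule conjunct2[OF exE[OF vs.projection_invariant_functionals[of V ?W F "average H"]]])
    show "?W \<subseteq> V" "?W \<subseteq> vs.span F" using V by (auto simp: invariants_def)
    show "average H (v + w) = average H v + average H w" if "v \<in> V" "w \<in> V" for v w
      using that by (simp add: average_def rep_add HG' sum.distrib vs.scale_right_distrib)
    show "average H (scale c v) = scale c (average H v)" if "v \<in> V" for c v
      using that by (simp add: average_def rep_scale HG' vs.scale_sum_right mult.commute)
    show "average H v \<in> ?W" if "v \<in> V" for v
      using that closed avg_fixed by (simp add: invariants_def)
  qed (use W V subspace_V subspace_invariants[OF HG] in auto)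
  also have "{\<phi> \<in> dual_space scale V. \<forall>v\<in>V. \<phi> (average H v) = \<phi> v} = invariants (dual_space scale V) (dual_rep G V \<pi>) H"
    using \<phi> by (auto simp: dual_invariants_eq[OF H(1)])
  finally show ?thesis .
qed

end

section \<open>The anti-involution and the operators it pairs\<close>

locale conjugacy_preserving_anti_involution = irreducible_representation G scale V \<pi>
  for G :: "('g, 'b) monoid_scheme" (structure)
    and scale :: "'f::alg_closed_field \<Rightarrow> 'v::ab_group_add \<Rightarrow> 'v" (infixr "*s" 75)
    and V :: "'v set" and \<pi> :: "'g \<Rightarrow> 'v \<Rightarrow> 'v" +
  fixes \<alpha> :: "'g \<Rightarrow> 'g"
  assumes finite_carrier: "finite (carrier G)"
    and anti: "anti_involution G \<alpha>"
    and conj: "preserves_conjugacy_classes G \<alpha>"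
begin

lemma \<alpha>_closed: "g \<in> carrier G \<Longrightarrow> \<alpha> g \<in> carrier G"
  and \<alpha>_mult: "g \<in> carrier G \<Longrightarrow> h \<in> carrier G \<Longrightarrow> \<alpha> (g \<otimes> h) = \<alpha> h \<otimes> \<alpha> g"
  and \<alpha>_\<alpha>: "g \<in> carrier G \<Longrightarrow> \<alpha> (\<alpha> g) = g"
  using anti by (auto simp: anti_involution_def)

text \<open>Fixed once, so that the traces of all operators refer to one basis.\<close>

definition basis :: "'v set" where
  "basis = (SOME B. finite B \<and> vs.independent B \<and> vs.span B = V)"

lemma basis: "finite basis" "vs.independent basis" "vs.span basis = V"
proof -
  obtain F where F: "finite F" "F \<subseteq> V" "vs.span F = V"
    using finite_dimensional[OF finite_carrier] by blast
  obtain B where B: "B \<subseteq> F" "vs.independent B" "F \<subseteq> vs.span B"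
    by (rule vs.maximal_independent_subset)
  have "vs.span B = V"
    using B F vs.span_mono[OF B(1)] vs.span_minimal[OF B(3) vs.subspace_span] by simp
  then have "finite B \<and> vs.independent B \<and> vs.span B = V"
    using B F finite_subset by blast
  then have "finite basis \<and> vs.independent basis \<and> vs.span basis = V"
    unfolding basis_def by (rule someI)
  then show "finite basis" "vs.independent basis" "vs.span basis = V" by auto
qed

definition proj :: "'v \<Rightarrow> 'v" where
  "proj = (SOME p. range p \<subseteq> V \<and> Vector_Spaces.linear scale scale p \<and> (\<forall>v\<in>V. p v = v))"

lemma proj: "range proj \<subseteq> V \<and> Vector_Spaces.linear scale scale proj \<and> (\<forall>v\<in>V. proj v = v)"
proof -
  interpret vector_space_pair scale scale ..
  have "\<exists>p. range p \<subseteq> V \<and> Vector_Spaces.linear scale scale p \<and> (\<forall>v\<in>V. p v = v)"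
    \<comment> \<open>A linear left inverse on \<open>V\<close> of the identity map, with range in
      \<open>V\<close>, is a projection onto \<open>V\<close>.\<close>
    by (rule linear_exists_left_inverse_on) (auto simp: subspace_V vs.linear_ident inj_on_def)
  then show ?thesis unfolding proj_def by (rule someI_ex)
qed

lemma proj_in: "proj v \<in> V" and proj_id: "v \<in> V \<Longrightarrow> proj v = v"
  and linear_proj: "Vector_Spaces.linear scale scale proj"
  using proj by auto

text \<open>Precomposing with the projection makes the operators linear on the whole ambient space.\<close>

definition ext :: "'g \<Rightarrow> 'v \<Rightarrow> 'v" where
  "ext g v = \<pi> g (proj v)"

lemma ext_in: "g \<in> carrier G \<Longrightarrow> ext g v \<in> V"
  by (simp add: ext_def rep_closed proj_in)

lemma ext_eq: "v \<in> V \<Longrightarrow> ext g v = \<pi> g v"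
  by (simp add: ext_def proj_id)

lemma ext_mult: "g \<in> carrier G \<Longrightarrow> h \<in> carrier G \<Longrightarrow> ext (g \<otimes> h) = (\<lambda>v. ext g (ext h v))"
  by (simp add: ext_def fun_eq_iff rep_mult proj_in proj_id rep_closed)

lemma ext_proj: "ext g (proj v) = ext g v"
  by (simp add: ext_def proj_id proj_in)

lemma linear_ext:
  assumes "g \<in> carrier G"
  shows "Vector_Spaces.linear scale scale (ext g)"
proof -
  interpret p: Vector_Spaces.linear scale scale proj by (rule linear_proj)
  show ?thesis
    by (simp add: Vector_Spaces.linear_iff vs.vector_space_axioms ext_def p.add p.scale rep_add rep_scale proj_in assms)
qed

text \<open>
  The graph of the map \<open>\<theta>\<close> on the span of the operators \<open>ext g\<close>; single-valuedness is only
  established in \<open>gpair_faithful\<close>.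
\<close>

inductive gpair :: "('v \<Rightarrow> 'v) \<Rightarrow> ('v \<Rightarrow> 'v) \<Rightarrow> bool" where
  base: "g \<in> carrier G \<Longrightarrow> gpair (ext g) (ext (\<alpha> g))"
| zero: "gpair (\<lambda>v. 0) (\<lambda>v. 0)"
| add: "gpair X X' \<Longrightarrow> gpair Y Y' \<Longrightarrow> gpair (\<lambda>v. X v + Y v) (\<lambda>v. X' v + Y' v)"
| scale: "gpair X X' \<Longrightarrow> gpair (\<lambda>v. c *s X v) (\<lambda>v. c *s X' v)"

text \<open>Generators are exchanged because \<open>\<alpha>\<close> is an involution. By symmetry,
  whatever is proved of first components holds of second components.\<close>

lemma gpair_sym: "gpair X X' \<Longrightarrow> gpair X' X"
proof (induction rule: gpair.induct)
  case (base g)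
  then show ?case using gpair.base[of "\<alpha> g"] by (simp add: \<alpha>_closed \<alpha>_\<alpha>)
qed (auto intro: gpair.intros)

lemma gpair_diff: "gpair X X' \<Longrightarrow> gpair Y Y' \<Longrightarrow> gpair (\<lambda>v. X v - c *s Y v) (\<lambda>v. X' v - c *s Y' v)"
  using gpair.add[OF _ gpair.scale, of X X' Y Y' "- c"] by simp

lemma gpair_in: "gpair X X' \<Longrightarrow> X v \<in> V"
  by (induction rule: gpair.induct)
    (use subspace_V in \<open>auto simp: ext_in vs.subspace_0 vs.subspace_add vs.subspace_scale\<close>)

lemma gpair_proj: "gpair X X' \<Longrightarrow> X (proj v) = X v"
  by (induction rule: gpair.induct) (auto simp: ext_proj)

lemma gpair_linear: "gpair X X' \<Longrightarrow> Vector_Spaces.linear scale scale X"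
proof (induction rule: gpair.induct)
  case (base g)
  then show ?case by (rule linear_ext)
qed (auto simp: Vector_Spaces.linear_iff algebra_simps mult.commute vs.vector_space_axioms)

lemma gpair_add: "gpair X X' \<Longrightarrow> X (v + w) = X v + X w"
  and gpair_scale: "gpair X X' \<Longrightarrow> X (c *s v) = c *s X v"
  and gpair_zero: "gpair X X' \<Longrightarrow> X 0 = 0"
  using gpair_linear[of X X']
  by (auto simp: Vector_Spaces.linear_iff) (metis vs.scale_zero_left)

text \<open>On generators the order is reversed because \<open>\<alpha>\<close> reverses products.
  The inner induction extends this to all \<open>Y\<close> by linearity of \<open>ext g\<close>, the
  outer one to all \<open>X\<close> by linearity of \<open>Y'\<close>.\<close>

lemma gpair_comp:
  assumes "gpair X X'" "gpair Y Y'"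
  shows "gpair (\<lambda>v. X (Y v)) (\<lambda>v. Y' (X' v))"
  using assms(1)
proof (induction rule: gpair.induct)
  case (base g)
  note g = this
  interpret g: Vector_Spaces.linear scale scale "ext g" using base by (rule linear_ext)
  show ?case using assms(2)
  proof (induction rule: gpair.induct)
    case (base h)
    then show ?case
      using gpair.base[of "g \<otimes> h"] g by (simp add: ext_mult \<alpha>_mult \<alpha>_closed)
  qed (auto simp: g.add g.scale g.zero intro: gpair.intros)
next
  case zero
  have "Y' 0 = 0" using gpair_zero[OF gpair_sym[OF assms(2)]] .
  then show ?case by (simp add: gpair.zero)
next
  case (add X X' Z Z')
  then show ?case using gpair.add[OF add.IH] by (simp add: gpair_add[OF gpair_sym[OF assms(2)]])
next
  case (scale X X' c)
  then show ?case using gpair.scale[OF scale.IH] by (simp add: gpair_scale[OF gpair_sym[OF assms(2)]])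
qed

section \<open>Traces of paired operators\<close>

abbreviation tr :: "('v \<Rightarrow> 'v) \<Rightarrow> 'f" where
  "tr \<equiv> trace_on scale basis"

text \<open>Cyclicity of the trace moves \<open>inv x\<close> to the front, where it cancels
  \<open>x\<close>.\<close>

lemma trace_ext_conj:
  assumes g: "g \<in> carrier G" "x \<in> carrier G"
  shows "tr (ext (x \<otimes> g \<otimes> inv x)) = tr (ext g)"
proof -
  have "tr (ext (x \<otimes> g \<otimes> inv x)) = tr (\<lambda>v. ext (x \<otimes> g) (ext (inv x) v))"
    using g by (simp add: ext_mult)
  also have "\<dots> = tr (\<lambda>v. ext (inv x) (ext (x \<otimes> g) v))"
    using g by (intro vs.trace_on_commute) (auto simp: basis ext_in linear_ext)
  also have "\<dots> = tr (ext (inv x \<otimes> (x \<otimes> g)))"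
    using g by (simp add: ext_mult)
  also have "inv x \<otimes> (x \<otimes> g) = g" using g by (simp flip: m_assoc)
  finally show ?thesis .
qed

text \<open>On generators, \<open>\<alpha> g\<close> is conjugate to \<open>g\<close>; the rest is
  linearity of the trace.\<close>

lemma trace_gpair: "gpair X X' \<Longrightarrow> tr X = tr X'"
proof (induction rule: gpair.induct)
  case (base g)
  then obtain x where "x \<in> carrier G" "\<alpha> g = x \<otimes> g \<otimes> inv x"
    using conj by (auto simp: preserves_conjugacy_classes_def)
  then show ?case using base by (simp add: trace_ext_conj)
next
  case (add X X' Y Y')
  then show ?case
    by (simp add: vs.trace_on_add basis gpair_in[OF add.hyps(1)] gpair_in[OF add.hyps(2)]
        gpair_in[OF gpair_sym[OF add.hyps(1)]] gpair_in[OF gpair_sym[OF add.hyps(2)]])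
next
  case (scale X X' c)
  then show ?case
    by (simp add: vs.trace_on_scale basis gpair_in[OF scale.hyps] gpair_in[OF gpair_sym[OF scale.hyps]])
qed simp

section \<open>Transitivity, rank one operators and faithfulness\<close>

definition operators :: "('v \<Rightarrow> 'v) set" where
  "operators = {X. \<exists>X'. gpair X X'}"

text \<open>The images of \<open>v\<close> under all operators form a \<open>G\<close>-stable
  subspace, which contains \<open>v\<close> through \<open>ext \<one>\<close>; irreducibility makes
  it \<open>V\<close>.\<close>

lemma operators_transitive:
  assumes v: "v \<in> V" "v \<noteq> 0" "w \<in> V"
  shows "\<exists>X\<in>operators. X v = w"
proof -
  let ?W = "{u. \<exists>X X'. gpair X X' \<and> u = X v}"
  have "?W = {0} \<or> ?W = V"
  proof (rule irreducible)
    show "vs.subspace ?W"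
    proof (rule vs.subspaceI)
      show "0 \<in> ?W" using gpair.zero by blast
      show "x + y \<in> ?W" if "x \<in> ?W" "y \<in> ?W" for x y
        using that gpair.add by fast
      show "c *s x \<in> ?W" if "x \<in> ?W" for c x
        using that gpair.scale by fast
    qed
    show "?W \<subseteq> V" using gpair_in by blast
    show "\<pi> g u \<in> ?W" if "g \<in> carrier G" "u \<in> ?W" for g u
    proof -
      obtain X X' where X: "gpair X X'" "u = X v" using \<open>u \<in> ?W\<close> by blast
      then have "\<pi> g u = ext g (X v)" by (simp add: ext_eq gpair_in)
      with gpair_comp[OF gpair.base[OF that(1)] X(1)] show ?thesis by blast
    qed
  qed
  moreover have "v \<in> ?W"
    using gpair.base[OF one_closed] ext_eq[OF v(1), of \<one>] rep_one[OF v(1)] by force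
  ultimately have "w \<in> ?W" using v(2,3) by blast
  then show ?thesis unfolding operators_def by blast
qed

text \<open>One rank one operator, with some \<open>\<phi>\<close> and \<open>y\<close>, suffices:
  composing it with operators that move \<open>y\<close> to \<open>x\<close> keeps
  \<open>\<phi>\<close> and reaches every \<open>x\<close>.\<close>

lemma rank_one_gpair:
  obtains \<phi> where "Vector_Spaces.linear scale (*) \<phi>" "\<And>x. x \<in> V \<Longrightarrow> (\<lambda>v. \<phi> v *s x) \<in> operators"
    "\<exists>v\<in>V. \<phi> v \<noteq> 0"
proof -
  have "\<exists>\<phi>. \<exists>y\<in>V. Vector_Spaces.linear scale (*) \<phi> \<and> (\<lambda>v. \<phi> v *s y) \<in> operators \<and> y \<noteq> 0 \<and> (\<exists>v. \<phi> v \<noteq> 0)"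
  proof (rule rank_one_operator_exists)
    show "vector_space scale" ..
    show "V \<subseteq> vs.span basis" "finite basis" using basis by auto
    show "range X \<subseteq> X ` V" if X: "X \<in> operators" for X
    proof
      fix u assume "u \<in> range X"
      then obtain v where "u = X v" by blast
      then have "u = X (proj v)" using X by (auto simp: operators_def gpair_proj)
      then show "u \<in> X ` V" using proj_in by blast
    qed
    show "(\<lambda>v. X (Y v)) \<in> operators" if "X \<in> operators" "Y \<in> operators" for X Y
      using that gpair_comp unfolding operators_def by blast
    show "(\<lambda>v. X v - c *s Y v) \<in> operators" if "X \<in> operators" "Y \<in> operators" for X Y c
      using that gpair_diff unfolding operators_def by blast
    obtain u where u: "u \<in> V" "u \<noteq> 0" using nontrivial subspace_V vs.subspace_0 by blast
    show "\<exists>X\<in>operators. \<exists>v. X v \<noteq> 0" using operators_transitive[OF u u(1)] u(2) by metis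
    show "\<exists>X\<in>operators. X v = w" if "v \<in> V" "v \<noteq> 0" "w \<in> V" for v w
      using that by (rule operators_transitive)
  qed (auto simp: subspace_V operators_def gpair_in gpair_linear)
  then obtain \<phi> y v where \<phi>: "Vector_Spaces.linear scale (*) \<phi>" "y \<in> V" "(\<lambda>v. \<phi> v *s y) \<in> operators" "y \<noteq> 0" "\<phi> v \<noteq> 0"
    by blast
  show thesis
  proof
    fix x assume "x \<in> V"
    then obtain X where X: "X \<in> operators" "X y = x" using operators_transitive \<phi> by blast
    then obtain X' Y' where *: "gpair X X'" "gpair (\<lambda>v. \<phi> v *s y) Y'"
      using \<phi>(3) by (auto simp: operators_def)
    have "(\<lambda>v. X (\<phi> v *s y)) = (\<lambda>v. \<phi> v *s x)" by (simp add: gpair_scale[OF *(1)] X(2))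
    then show "(\<lambda>v. \<phi> v *s x) \<in> operators"
      using gpair_comp[OF *] unfolding operators_def by auto
  next
    obtain Y' where "gpair (\<lambda>v. \<phi> v *s y) Y'" using \<phi>(3) by (auto simp: operators_def)
    \<comment> \<open>\<open>\<phi>\<close> factors through \<open>proj\<close>, so it cannot vanish
      on all of \<open>V\<close>.\<close>
    from gpair_proj[OF this, of v] have "\<phi> (proj v) = \<phi> v" using \<phi>(4) by simp
    then show "\<exists>v\<in>V. \<phi> v \<noteq> 0" using \<phi>(5) proj_in by metis
  qed (fact \<phi>)
qed

text \<open>
  If \<open>\<theta> 0 = X'\<close>, then \<open>X'\<close> is orthogonal to \<open>A\<close> under the trace form, in particular to the rank one
  operators \<open>u \<mapsto> \<phi> (Z u) *s x\<close>, where the trace is \<open>\<phi> (Z (X' x))\<close>.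
\<close>

lemma gpair_faithful:
  assumes "gpair (\<lambda>v. 0) X'"
  shows "X' = (\<lambda>v. 0)"
proof (rule ccontr)
  assume "X' \<noteq> (\<lambda>v. 0)"
  then obtain x where x: "X' (proj x) \<noteq> 0" using gpair_proj[OF gpair_sym[OF assms]] by metis
  obtain \<phi> where \<phi>: "Vector_Spaces.linear scale (*) \<phi>" "\<And>x. x \<in> V \<Longrightarrow> (\<lambda>v. \<phi> v *s x) \<in> operators"
    "\<exists>v\<in>V. \<phi> v \<noteq> 0" by (rule rank_one_gpair) (rule that)
  then obtain u where u: "u \<in> V" "\<phi> u \<noteq> 0" by blast
  interpret \<phi>: Vector_Spaces.linear scale "(*)" \<phi> by fact
  \<comment> \<open>\<open>Z\<close> moves the nonzero vector \<open>X' (proj x)\<close> to one on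
    which \<open>\<phi>\<close> is nonzero; that value will be the trace.\<close>
  obtain Z Z' where Z: "gpair Z Z'" "Z (X' (proj x)) = u"
    using operators_transitive[OF _ x u(1)] gpair_in[OF gpair_sym[OF assms]] by (auto simp: operators_def)
  interpret Z: Vector_Spaces.linear scale scale Z by (rule gpair_linear[OF Z(1)])
  obtain R' where R: "gpair (\<lambda>v. \<phi> v *s proj x) R'"
    using \<phi>(2)[OF proj_in] by (auto simp: operators_def)
  have Y: "gpair (\<lambda>v. \<phi> (Z v) *s proj x) (\<lambda>v. Z' (R' v))" using gpair_comp[OF R Z(1)] .
  \<comment> \<open>Composing the reversed pair from \<open>Y\<close> with the pair of
    \<open>0\<close> and \<open>X'\<close> relates the constant \<open>Z' (R' 0)\<close>, which is
    \<open>0\<close>, to \<open>X'\<close> after the rank one operator. Paired operators have equal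
    traces.\<close>
  have "0 = tr (\<lambda>v. Z' (R' 0))"
    using gpair_zero[OF gpair_sym[OF R]] gpair_zero[OF gpair_sym[OF Z(1)]] by (simp add: vs.trace_on_zero basis)
  also have "\<dots> = tr (\<lambda>v. X' (\<phi> (Z v) *s proj x))"
    using trace_gpair[OF gpair_comp[OF gpair_sym[OF Y] assms]] by simp
  also have "\<dots> = tr (\<lambda>v. \<phi> (Z v) *s X' (proj x))"
    by (simp add: gpair_scale[OF gpair_sym[OF assms]])
  also have "\<dots> = \<phi> (Z (X' (proj x)))"
    by (rule vs.trace_on_rank_one)
      (auto simp: basis gpair_in[OF gpair_sym[OF assms]] Vector_Spaces.linear_iff vs.vector_space_axioms
        vector_space_mult \<phi>.add \<phi>.scale Z.add Z.scale)
  finally show False using Z u by simp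
qed

section \<open>The equivariant isomorphism of \<open>V\<close> with its dual\<close>

lemma gpair_unique:
  assumes "gpair X Y" "gpair X Z"
  shows "Y = Z"
  using gpair_faithful[of "\<lambda>v. Y v - 1 *s Z v"] gpair_diff[OF assms, of 1] by (auto simp: fun_eq_iff)

text \<open>\<open>\<Phi> x\<close> is the form \<open>B x\<close> with \<open>\<psi>\<close> a
  coordinate function. Equivariance makes the kernel stable, so irreducibility gives injectivity,
  and equality of dimensions gives surjectivity.\<close>

lemma equivariant_dual_isomorphism:
  obtains \<Phi> where "Vector_Spaces.linear scale fun_scale \<Phi>" "inj_on \<Phi> V" "\<Phi> ` V = dual_space scale V"
    "\<And>g x v. g \<in> carrier G \<Longrightarrow> x \<in> V \<Longrightarrow> v \<in> V \<Longrightarrow> \<Phi> (\<pi> g x) v = \<Phi> x (\<pi> (\<alpha> g) v)"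
proof -
  interpret D: vector_space "fun_scale :: 'f \<Rightarrow> ('v \<Rightarrow> 'f) \<Rightarrow> 'v \<Rightarrow> 'f"
    by (rule vector_space_fun_scale)
  interpret P: vector_space_pair scale "fun_scale :: 'f \<Rightarrow> ('v \<Rightarrow> 'f) \<Rightarrow> 'v \<Rightarrow> 'f" ..
  obtain \<phi> where \<phi>: "Vector_Spaces.linear scale (*) \<phi>" "\<And>x. x \<in> V \<Longrightarrow> (\<lambda>v. \<phi> v *s x) \<in> operators"
    "\<exists>v\<in>V. \<phi> v \<noteq> 0" by (rule rank_one_gpair) (rule that)
  \<comment> \<open>The image under \<open>\<theta>\<close> of the rank one operator with vector
    \<open>proj x\<close>; \<open>proj\<close> makes \<open>\<Theta>\<close> linear on the whole
    ambient space.\<close>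
  define \<Theta> where "\<Theta> x = (SOME R. gpair (\<lambda>v. \<phi> v *s proj x) R)" for x
  have \<Theta>: "gpair (\<lambda>v. \<phi> v *s proj x) (\<Theta> x)" for x
  proof -
    have "\<exists>R. gpair (\<lambda>v. \<phi> v *s proj x) R" using \<phi>(2)[OF proj_in] by (simp add: operators_def)
    then show ?thesis unfolding \<Theta>_def by (rule someI_ex)
  qed
  have \<Theta>_eqI: "\<Theta> x = R" if "gpair (\<lambda>v. \<phi> v *s proj x) R" for x R
    using gpair_unique[OF \<Theta> that] .
  interpret p: Vector_Spaces.linear scale scale proj by (rule linear_proj)
  have \<Theta>_add: "\<Theta> (x + y) = (\<lambda>v. \<Theta> x v + \<Theta> y v)" for x y
    using gpair.add[OF \<Theta>[of x] \<Theta>[of y]] by (intro \<Theta>_eqI) (simp add: p.add vs.scale_right_distrib)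
  have \<Theta>_scale: "\<Theta> (c *s x) = (\<lambda>v. c *s \<Theta> x v)" for c x
    using gpair.scale[OF \<Theta>[of x], of c] by (intro \<Theta>_eqI) (simp add: p.scale mult.commute)
  \<comment> \<open>Applying \<open>\<pi> g\<close> after the rank one operator moves its vector
    \<open>x\<close>; the order reversal in \<open>gpair_comp\<close> turns this into applying
    \<open>\<alpha> g\<close> first.\<close>
  have \<Theta>_rep: "\<Theta> (\<pi> g x) = (\<lambda>v. \<Theta> x (ext (\<alpha> g) v))" if "g \<in> carrier G" "x \<in> V" for g x
  proof (rule \<Theta>_eqI)
    have "(\<lambda>v. \<phi> v *s proj (\<pi> g x)) = (\<lambda>v. ext g (\<phi> v *s proj x))"
      using that by (simp add: ext_def p.scale proj_id rep_closed rep_scale)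
    then show "gpair (\<lambda>v. \<phi> v *s proj (\<pi> g x)) (\<lambda>v. \<Theta> x (ext (\<alpha> g) v))"
      using gpair_comp[OF gpair.base[OF that(1)] \<Theta>[of x]] by simp
  qed
  have \<Theta>_in: "\<Theta> x v \<in> vs.span basis" for x v
    using gpair_in[OF gpair_sym[OF \<Theta>]] basis by simp
  obtain x0 where x0: "x0 \<in> V" "x0 \<noteq> 0" using nontrivial subspace_V vs.subspace_0 by blast
  \<comment> \<open>Faithfulness for the reversed pair: a zero partner would make the rank one
    operator itself zero.\<close>
  have "\<Theta> x0 \<noteq> (\<lambda>v. 0)"
  proof
    assume "\<Theta> x0 = (\<lambda>v. 0)"
    then have "gpair (\<lambda>v. 0) (\<lambda>v. \<phi> v *s proj x0)" using gpair_sym[OF \<Theta>[of x0]] by simp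
    from gpair_faithful[OF this] show False using \<phi>(3) x0 by (auto simp: fun_eq_iff proj_id)
  qed
  then obtain w0 where "\<Theta> x0 w0 \<noteq> 0" by auto
  \<comment> \<open>A nonzero vector has a nonzero coordinate; the resulting \<open>b\<close>
    supplies \<open>\<psi>\<close>.\<close>
  then have "(\<Sum>b\<in>basis. vs.representation basis (\<Theta> x0 w0) b *s b) \<noteq> 0"
    by (subst vs.sum_representation_eq) (auto simp: basis \<Theta>_in[unfolded basis(3)])
  then obtain b where b: "vs.representation basis (\<Theta> x0 w0) b \<noteq> 0"
    by (metis (no_types, lifting) sum.neutral vs.scale_zero_left)
  define \<Phi> where "\<Phi> x = (\<lambda>v. if v \<in> V then vs.representation basis (\<Theta> x v) b else 0)" for x
  have lin: "Vector_Spaces.linear scale fun_scale \<Phi>"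
    by (auto simp: Vector_Spaces.linear_iff vs.vector_space_axioms D.vector_space_axioms \<Phi>_def \<Theta>_add \<Theta>_scale
        vs.representation_add vs.representation_scale basis(2) \<Theta>_in fun_scale_def fun_eq_iff)
  have rep: "\<Phi> (\<pi> g x) v = \<Phi> x (\<pi> (\<alpha> g) v)" if "g \<in> carrier G" "x \<in> V" "v \<in> V" for g x v
    using that by (simp add: \<Phi>_def \<Theta>_rep ext_eq rep_closed \<alpha>_closed)
  interpret \<Phi>: Vector_Spaces.linear scale fun_scale \<Phi> by (rule lin)
  have \<Phi>0: "\<Phi> x0 \<noteq> 0"
  proof
    assume "\<Phi> x0 = 0"
    \<comment> \<open>\<open>w0\<close> may lie outside \<open>V\<close>, where
      \<open>\<Phi> x0\<close> is cut off to \<open>0\<close>, so the evaluation is at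
      \<open>proj w0\<close>.\<close>
    then have "\<Phi> x0 (proj w0) = 0" by simp
    then show False using b by (simp add: \<Phi>_def proj_in gpair_proj[OF gpair_sym[OF \<Theta>]])
  qed
  let ?K = "{x \<in> V. \<Phi> x = 0}"
  have "?K = {0} \<or> ?K = V"
  proof (rule irreducible)
    show "vs.subspace ?K"
      by (rule vs.subspaceI)
        (auto simp: \<Phi>.add \<Phi>.scale \<Phi>.zero vs.subspace_0 vs.subspace_add vs.subspace_scale subspace_V)
    show "\<pi> g x \<in> ?K" if "g \<in> carrier G" "x \<in> ?K" for g x
    proof -
      have "\<Phi> (\<pi> g x) v = 0" for v
        using that rep[of g x v] by (cases "v \<in> V") (auto simp: \<Phi>_def)
      then show ?thesis using that by (auto simp: rep_closed fun_eq_iff)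
    qed
  qed auto
  then have K: "?K = {0}" using \<Phi>0 x0 by blast
  have inj: "inj_on \<Phi> V"
  proof (rule inj_onI)
    fix x y assume "x \<in> V" "y \<in> V" "\<Phi> x = \<Phi> y"
    then have "x - y \<in> ?K" by (simp add: \<Phi>.diff vs.subspace_diff[OF subspace_V])
    then show "x = y" unfolding K by simp
  qed
  have sub: "\<Phi> ` V \<subseteq> dual_space scale V"
  proof
    fix f assume "f \<in> \<Phi> ` V"
    then obtain x where f: "f = \<Phi> x" by blast
    show "f \<in> dual_space scale V" unfolding f using subspace_V gpair_sym[OF \<Theta>[of x]]
      by (auto simp: dual_space_def \<Phi>_def vs.subspace_add vs.subspace_scale gpair_add gpair_scale
          vs.representation_add vs.representation_scale basis(2) \<Theta>_in)
  qed
  \<comment> \<open>Taking the identity as the projection makes the condition void and shows that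
    the dual has the dimension of \<open>V\<close>.\<close>
  have *: "{f \<in> dual_space scale V. \<forall>v\<in>V. f v = f v} = dual_space scale V" by simp
  obtain C where C: "finite C" "D.span C = dual_space scale V" "D.dim (dual_space scale V) = vs.dim V"
    using vs.projection_invariant_functionals[OF subspace_V subspace_V, of basis "\<lambda>v. v"] basis by (auto simp: *)
  have "\<Phi> ` V = dual_space scale V"
    by (rule D.subspace_eq_if_dim_ge[OF \<Phi>.subspace_image[OF subspace_V] sub])
      (use C P.dim_inj_linear_image[OF lin subspace_V inj] in auto)
  then show thesis using rep by (rule that[OF lin inj])
qed

text \<open>By equivariance, invariance of the functional \<open>\<Phi> x\<close> under
  \<open>\<alpha> h\<close> is invariance of \<open>x\<close> under \<open>h\<close>, so
  \<open>\<Phi>\<close> restricts to a bijection between the two spaces of invariants.\<close>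

lemma dim_dual_invariants:
  assumes H: "subgroup H G" "\<alpha> ` H = H"
  shows "vector_space.dim fun_scale (invariants (dual_space scale V) (dual_rep G V \<pi>) H) =
    vs.dim (invariants V \<pi> H)"
proof -
  interpret D: vector_space "fun_scale :: 'f \<Rightarrow> ('v \<Rightarrow> 'f) \<Rightarrow> 'v \<Rightarrow> 'f"
    by (rule vector_space_fun_scale)
  interpret P: vector_space_pair scale "fun_scale :: 'f \<Rightarrow> ('v \<Rightarrow> 'f) \<Rightarrow> 'v \<Rightarrow> 'f" ..
  obtain \<Phi> where \<Phi>: "Vector_Spaces.linear scale fun_scale \<Phi>" "inj_on \<Phi> V" "\<Phi> ` V = dual_space scale V"
    "\<And>g x v. g \<in> carrier G \<Longrightarrow> x \<in> V \<Longrightarrow> v \<in> V \<Longrightarrow> \<Phi> (\<pi> g x) v = \<Phi> x (\<pi> (\<alpha> g) v)"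
    by (rule equivariant_dual_isomorphism) blast
  have HG: "h \<in> carrier G" if "h \<in> H" for h using that H(1) by (rule subgroup.mem_carrier[rotated])
  have *: "(\<forall>h\<in>H. \<forall>v\<in>V. \<Phi> x (\<pi> h v) = \<Phi> x v) \<longleftrightarrow> (\<forall>h\<in>H. \<pi> h x = x)" if x: "x \<in> V" for x
  proof -
    \<comment> \<open>Since \<open>\<alpha>\<close> preserves \<open>H\<close>, every element of
      \<open>H\<close> may be written as \<open>\<alpha> h\<close>, the form to which equivariance
      applies.\<close>
    have "(\<forall>h\<in>H. \<forall>v\<in>V. \<Phi> x (\<pi> h v) = \<Phi> x v) \<longleftrightarrow> (\<forall>h\<in>\<alpha> ` H. \<forall>v\<in>V. \<Phi> x (\<pi> h v) = \<Phi> x v)"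
      by (simp add: H(2))
    also have "\<dots> \<longleftrightarrow> (\<forall>h\<in>H. \<forall>v\<in>V. \<Phi> (\<pi> h x) v = \<Phi> x v)"
      using x by (simp add: \<Phi>(4) HG)
    also have "\<dots> \<longleftrightarrow> (\<forall>h\<in>H. \<Phi> (\<pi> h x) = \<Phi> x)"
    proof -
      have "\<Phi> y v = 0" if "y \<in> V" "v \<notin> V" for y v
        using \<Phi>(3) that by (auto simp: dual_space_def)
      then show ?thesis using x by (metis HG ext rep_closed)
    qed
    also have "\<dots> \<longleftrightarrow> (\<forall>h\<in>H. \<pi> h x = x)"
      using x \<Phi>(2) by (metis HG inj_onD rep_closed)
    finally show ?thesis .
  qed
  have "invariants (dual_space scale V) (dual_rep G V \<pi>) H =
      {\<phi> \<in> \<Phi> ` V. \<forall>h\<in>H. \<forall>v\<in>V. \<phi> (\<pi> h v) = \<phi> v}"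
    by (simp add: dual_invariants_eq[OF H(1)] \<Phi>(3))
  also have "\<dots> = \<Phi> ` invariants V \<pi> H"
    using * by (auto simp: invariants_def)
  finally have "invariants (dual_space scale V) (dual_rep G V \<pi>) H = \<Phi> ` invariants V \<pi> H" .
  moreover have "inj_on \<Phi> (invariants V \<pi> H)"
    using \<Phi>(2) by (rule inj_on_subset) (auto simp: invariants_def)
  ultimately show ?thesis
    using P.dim_inj_linear_image[OF \<Phi>(1) subspace_invariants] subgroup.subset[OF H(1)] by simp
qed

end

section \<open>The two cases of the theorem\<close>

theorem lemma1p3:
  fixes G :: "('g, 'b) monoid_scheme"
    and H :: "'g set"
    and scale :: "'f::alg_closed_field \<Rightarrow> 'v::ab_group_add \<Rightarrow> 'v"
    and V :: "'v set"
    and \<pi> :: "'g \<Rightarrow> 'v \<Rightarrow> 'v"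
  assumes "CHAR('f) \<noteq> 2"
    and "group G" and "finite (carrier G)"
    and "subgroup H G"
    and "irreducible_representation G scale V \<pi>"
    and "\<not> CHAR('f) dvd Coset.order G \<or>
      (\<exists>\<alpha>. anti_involution G \<alpha> \<and> \<alpha> ` H = H \<and> preserves_conjugacy_classes G \<alpha>)"
  shows "vector_space.dim scale (invariants V \<pi> H) =
    vector_space.dim fun_scale (invariants (dual_space scale V) (dual_rep G V \<pi>) H)"
proof -
  interpret irreducible_representation G scale V \<pi> by fact
  from assms(6) show ?thesis
  proof (elim disjE exE conjE)
    assume char: "\<not> CHAR('f) dvd Coset.order G"
    \<comment> \<open>Lagrange passes the condition on the characteristic from \<open>G\<close> to
      \<open>H\<close>. As \<open>0 dvd n\<close> only for \<open>n = 0\<close>, characteristic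
      \<open>0\<close> falls under this case.\<close>
    have "card H dvd Coset.order G"
      using lagrange[OF assms(4)] by (metis dvd_triv_right)
    then have "of_nat (card H) \<noteq> (0::'f)"
      using char by (metis dvd_trans of_nat_eq_0_iff_char_dvd)
    moreover have "finite H"
      using assms(3,4) finite_subset subgroup.subset by blast
    moreover obtain F where "finite F" "vs.span F = V"
      using finite_dimensional[OF assms(3)] by blast
    ultimately show ?thesis
      using dim_dual_invariants_nonmodular[OF assms(4), of F] by simp
  next
    fix \<alpha> assume \<alpha>: "anti_involution G \<alpha>" "\<alpha> ` H = H" "preserves_conjugacy_classes G \<alpha>"
    interpret conjugacy_preserving_anti_involution G scale V \<pi> \<alpha>
      by unfold_locales (fact assms \<alpha>)+
    show ?thesis using dim_dual_invariants[OF assms(4) \<alpha>(2)] by simp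
  qed
qed

end
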